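(* Let $G$ be a connected simple graph with vertex set $\{v_1,\dots,v_n\}$ and let $\Phi=(G,\varphi)$ be a $\mathbb{T}$-gain graph on $G$. Then $\Phi$ is balanced if and only if $\Phi$ is ordering independent, $\mathcal{DL}^{\max}(\Phi)=\mathcal{DL}^{\min}(\Phi)$ (this common matrix being denoted $\mathcal{DL}(\Phi)$), and $\mathcal{DL}(\Phi)$ has the same spectrum (eigenvalues with multiplicities) as $\mathcal{DL}(G)$.
   Context: $\mathbb{T}=\{z\in\mathbb{C}:|z|=1\}$. A $\mathbb{T}$-gain graph $\Phi=(G,\varphi)$ assigns to each of the two orientations $\vec e_{i,j},\vec e_{j,i}$ of every edge $v_iv_j$ of $G$ a gain in $\mathbb{T}$ with $\varphi(\vec e_{j,i})=\overline{\varphi(\vec e_{i,j})}$. The gain of an oriented path or oriented cycle is the product of the gains of its consecutive oriented edges; $\Phi$ is balanced if every cycle has gain $1$. $d(u,v)$ is the shortest-path distance in $G$. For a total order $<$ on $V(G)$ and vertices $s<t$, $\varphi^{<}_{\max}(s,t)$ (resp. $\varphi^{<}_{\min}(s,t)$) is the maximum (resp. minimum) of the gains of all shortest oriented paths from $s$ to $t$, with respect to the lexicographic order on $\mathbb{C}$ ($a+ib\le c+id$ iff $a<c$, or $a=c$ and $b\le d$); further $\varphi^{<}_{\max}(t,s)=\overline{\varphi^{<}_{\max}(s,t)}$, $\varphi^{<}_{\min}(t,s)=\overline{\varphi^{<}_{\min}(s,t)}$, and both are $0$ on pairs $(s,s)$. The gain distance matrices are $\mathcal{D}^{\max}_{<}(\Phi)=(\varphi^{<}_{\max}(v_i,v_j)d(v_i,v_j))_{i,j}$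 and $\mathcal{D}^{\min}_{<}(\Phi)=(\varphi^{<}_{\min}(v_i,v_j)d(v_i,v_j))_{i,j}$. The transmission of $v_i$ is $\mathrm{Tr}(v_i)=\sum_j d(v_i,v_j)$, and $\mathrm{Tr}(G)=\mathrm{diag}(\mathrm{Tr}(v_1),\dots,\mathrm{Tr}(v_n))$. Let $<$ be the standard order $v_1<\dots<v_n$ and $<_r$ its reverse. $\Phi$ is ordering independent if $\mathcal{D}^{\max}_{<}(\Phi)=\mathcal{D}^{\max}_{<_r}(\Phi)$ and $\mathcal{D}^{\min}_{<}(\Phi)=\mathcal{D}^{\min}_{<_r}(\Phi)$; then $\mathcal{D}^{\max}(\Phi)$, $\mathcal{D}^{\min}(\Phi)$ denote these common matrices and $\mathcal{DL}^{\max}(\Phi)=\mathrm{Tr}(G)-\mathcal{D}^{\max}(\Phi)$, $\mathcal{DL}^{\min}(\Phi)=\mathrm{Tr}(G)-\mathcal{D}^{\min}(\Phi)$. $\mathcal{DL}(G)=\mathrm{Tr}(G)-\mathcal{D}(G)$, where $\mathcal{D}(G)=(d(v_i,v_j))$ is the distance matrix of $G$. *)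

theory Defs
  imports
    "Graph_Theory.Graph_Theory"
    "Jordan_Normal_Form.Char_Poly"
    "HOL-Computational_Algebra.Polynomial"
begin

text \<open>
  A simple graph is a symmetric loop-free digraph on pairs (locale \<^locale>\<open>pair_graph\<close>): each edge
  is present as its two orientations \<open>(u, v)\<close> and \<open>(v, u)\<close>. The vertices \<open>v\<^sub>1, \<dots>, v\<^sub>n\<close> are
  identified with their zero-based matrix indices \<open>0, \<dots>, n - 1\<close>, so that the standard order is
  \<open>(<)\<close> on \<^typ>\<open>nat\<close> and its reverse is \<open>(>)\<close>. Only the values of a gain function on the arcs of
  the graph matter.
\<close>

definition is_T_gain :: "'a pair_pre_digraph \<Rightarrow> ('a \<times> 'a \<Rightarrow> complex) \<Rightarrow> bool" where
  "is_T_gain G \<phi> \<longleftrightarrow>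
     (\<forall>u v. (u, v) \<in> parcs G \<longrightarrow> cmod (\<phi> (u, v)) = 1 \<and> \<phi> (v, u) = cnj (\<phi> (u, v)))"

definition walk_gain :: "('a \<times> 'a \<Rightarrow> complex) \<Rightarrow> ('a \<times> 'a) list \<Rightarrow> complex" where
  "walk_gain \<phi> p = prod_list (map \<phi> p)"

text \<open>
  \<^const>\<open>pre_digraph.cycle\<close> also counts a walk back and forth along one edge as a cycle; the length
  bound leaves exactly the oriented cycles of the underlying simple graph.
\<close>

definition balanced :: "'a pair_pre_digraph \<Rightarrow> ('a \<times> 'a \<Rightarrow> complex) \<Rightarrow> bool" where
  "balanced G \<phi> \<longleftrightarrow>
     (\<forall>p. pre_digraph.cycle (with_proj G) p \<and> 3 \<le> length p \<longrightarrow> walk_gain \<phi> p = 1)"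

definition gdist :: "'a pair_pre_digraph \<Rightarrow> 'a \<Rightarrow> 'a \<Rightarrow> real" where
  "gdist G u v = real_of_ereal (wf_digraph.\<mu> (with_proj G) (\<lambda>_. 1) u v)"

definition shortest_paths :: "'a pair_pre_digraph \<Rightarrow> 'a \<Rightarrow> 'a \<Rightarrow> ('a \<times> 'a) list set" where
  "shortest_paths G u v =
     {p. pre_digraph.apath (with_proj G) u p v \<and> real (length p) = gdist G u v}"

definition lex_le :: "complex \<Rightarrow> complex \<Rightarrow> bool" where
  "lex_le z w \<longleftrightarrow> Re z < Re w \<or> (Re z = Re w \<and> Im z \<le> Im w)"

definition lex_Max :: "complex set \<Rightarrow> complex" where
  "lex_Max S = (THE z. z \<in> S \<and> (\<forall>w\<in>S. lex_le w z))"

definition lex_Min :: "complex set \<Rightarrow> complex" where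
  "lex_Min S = (THE z. z \<in> S \<and> (\<forall>w\<in>S. lex_le z w))"

text \<open>In the following, \<open>lt\<close> is a strict total order on the vertices.\<close>

definition gain_max ::
  "('a \<Rightarrow> 'a \<Rightarrow> bool) \<Rightarrow> 'a pair_pre_digraph \<Rightarrow> ('a \<times> 'a \<Rightarrow> complex) \<Rightarrow> 'a \<Rightarrow> 'a \<Rightarrow> complex" where
  "gain_max lt G \<phi> s t =
     (if s = t then 0
      else if lt s t then lex_Max (walk_gain \<phi> ` shortest_paths G s t)
      else cnj (lex_Max (walk_gain \<phi> ` shortest_paths G t s)))"

definition gain_min ::
  "('a \<Rightarrow> 'a \<Rightarrow> bool) \<Rightarrow> 'a pair_pre_digraph \<Rightarrow> ('a \<times> 'a \<Rightarrow> complex) \<Rightarrow> 'a \<Rightarrow> 'a \<Rightarrow> complex" where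
  "gain_min lt G \<phi> s t =
     (if s = t then 0
      else if lt s t then lex_Min (walk_gain \<phi> ` shortest_paths G s t)
      else cnj (lex_Min (walk_gain \<phi> ` shortest_paths G t s)))"

definition D_max ::
  "(nat \<Rightarrow> nat \<Rightarrow> bool) \<Rightarrow> nat \<Rightarrow> nat pair_pre_digraph \<Rightarrow> (nat \<times> nat \<Rightarrow> complex) \<Rightarrow> complex mat" where
  "D_max lt n G \<phi> = mat n n (\<lambda>(i, j). gain_max lt G \<phi> i j * complex_of_real (gdist G i j))"

definition D_min ::
  "(nat \<Rightarrow> nat \<Rightarrow> bool) \<Rightarrow> nat \<Rightarrow> nat pair_pre_digraph \<Rightarrow> (nat \<times> nat \<Rightarrow> complex) \<Rightarrow> complex mat" where
  "D_min lt n G \<phi> = mat n n (\<lambda>(i, j). gain_min lt G \<phi> i j * complex_of_real (gdist G i j))"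

definition ordering_independent ::
  "nat \<Rightarrow> nat pair_pre_digraph \<Rightarrow> (nat \<times> nat \<Rightarrow> complex) \<Rightarrow> bool" where
  "ordering_independent n G \<phi> \<longleftrightarrow>
     D_max (<) n G \<phi> = D_max (>) n G \<phi> \<and> D_min (<) n G \<phi> = D_min (>) n G \<phi>"

definition transmission :: "'a pair_pre_digraph \<Rightarrow> 'a \<Rightarrow> real" where
  "transmission G u = (\<Sum>v\<in>pverts G. gdist G u v)"

definition Tr_mat :: "nat \<Rightarrow> nat pair_pre_digraph \<Rightarrow> complex mat" where
  "Tr_mat n G = mat_diag n (\<lambda>i. complex_of_real (transmission G i))"

definition dist_mat :: "nat \<Rightarrow> nat pair_pre_digraph \<Rightarrow> complex mat" where
  "dist_mat n G = mat n n (\<lambda>(i, j). complex_of_real (gdist G i j))"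

definition DL :: "nat \<Rightarrow> nat pair_pre_digraph \<Rightarrow> complex mat" where
  "DL n G = Tr_mat n G - dist_mat n G"

text \<open>
  The next two matrices are meant for ordering independent gain graphs, where the choice of the
  standard order is immaterial.
\<close>

definition DL_max :: "nat \<Rightarrow> nat pair_pre_digraph \<Rightarrow> (nat \<times> nat \<Rightarrow> complex) \<Rightarrow> complex mat" where
  "DL_max n G \<phi> = Tr_mat n G - D_max (<) n G \<phi>"

definition DL_min :: "nat \<Rightarrow> nat pair_pre_digraph \<Rightarrow> (nat \<times> nat \<Rightarrow> complex) \<Rightarrow> complex mat" where
  "DL_min n G \<phi> = Tr_mat n G - D_min (<) n G \<phi>"

text \<open>Eigenvalues with (algebraic) multiplicities.\<close>

definition spectrum_mset :: "complex mat \<Rightarrow> complex multiset" where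
  "spectrum_mset A = proots (char_poly A)"

end

theory Submission
  imports Defs
begin

text \<open>
  If \<open>\<Phi>\<close> is balanced, the gain of a walk depends only on its ends, so with \<open>\<theta>(u)\<close> the gain of any
  walk from \<open>u\<close> to a fixed root, every walk from \<open>u\<close> to \<open>v\<close> has gain \<open>\<theta>(u) * cnj \<theta>(v)\<close>. Hence the
  gain distance Laplacians are all equal to \<open>diag \<theta> * DL(G) * diag \<theta>\<^sup>-\<^sup>1\<close>.
  Conversely, the all-ones vector lies in the kernel of \<open>DL(G)\<close>, so a matrix with the same spectrum
  has a kernel vector \<open>x \<noteq> 0\<close>. Looking at the row of an entry of maximal modulus, the equality
  case of the triangle inequality makes all entries of \<open>x\<close> of equal modulus, and then
  \<open>x\<^sub>i = \<gamma>\<^sub>i\<^sub>j x\<^sub>j\<close> for all \<open>i \<noteq> j\<close>. On edges \<open>\<gamma> = \<phi>\<close>, so \<open>x\<close> trivialises the gain of every cycle.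
\<close>

section \<open>Gains of walks, potentials and balance\<close>

lemma walk_gain_simps [simp]:
  "walk_gain \<phi> [] = 1"
  "walk_gain \<phi> (e # p) = \<phi> e * walk_gain \<phi> p"
  "walk_gain \<phi> (p @ q) = walk_gain \<phi> p * walk_gain \<phi> q"
  by (simp_all add: walk_gain_def)

context pair_graph
begin

lemma cmod_walk_gain:
  assumes "is_T_gain G \<phi>" "awalk u p v"
  shows "cmod (walk_gain \<phi> p) = 1"
  using assms(2)
proof (induction p arbitrary: u)
  case (Cons e p)
  then show ?case
    using assms(1) by (cases e) (auto simp: awalk_Cons_iff is_T_gain_def norm_mult)
qed simp

lemma walk_gain_rev_path:
  assumes "is_T_gain G \<phi>" "awalk u p v"
  shows "walk_gain \<phi> (rev_path p) = cnj (walk_gain \<phi> p)"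
  using assms(2)
proof (induction p arbitrary: u)
  case (Cons e p)
  then show ?case
    using assms(1) by (cases e) (auto simp: awalk_Cons_iff is_T_gain_def)
qed simp

text \<open>The relation on arcs telescopes along a walk.\<close>

lemma walk_gain_potential:
  assumes "\<And>u v. (u, v) \<in> parcs G \<Longrightarrow> x u = \<phi> (u, v) * x v" "awalk u p v"
  shows "x u = walk_gain \<phi> p * x v"
  using assms(2)
proof (induction p arbitrary: u)
  case Nil
  then show ?case by (simp add: awalk_Nil_iff)
next
  case (Cons e p)
  then show ?case
    using assms(1) by (cases e) (auto simp: awalk_Cons_iff)
qed

text \<open>On a closed walk the telescoped relation reads
  \<open>x u = walk_gain \<phi> p * x u\<close>, and the nonzero factor cancels.\<close>

lemma balanced_if_potential:
  assumes "\<And>u v. (u, v) \<in> parcs G \<Longrightarrow> x u = \<phi> (u, v) * x v"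
    and "\<And>u. u \<in> pverts G \<Longrightarrow> x u \<noteq> 0"
  shows "balanced G \<phi>"
  unfolding balanced_def
proof (intro allI impI)
  fix p
  assume "cycle p \<and> 3 \<le> length p"
  then obtain u where u: "awalk u p u"
    by (auto simp: cycle_def)
  then have "x u = walk_gain \<phi> p * x u"
    using walk_gain_potential[of x \<phi> u p u] assms(1) by blast
  moreover have "x u \<noteq> 0"
    using u assms(2) awalk_hd_in_verts by blast
  ultimately show "walk_gain \<phi> p = 1"
    by simp
qed

text \<open>Strong induction on the length: if the closed walk repeats a vertex after its first arc,
  a closed subwalk can be cut out; otherwise it is a cycle or runs along one edge and back.\<close>

lemma closed_walk_gain_eq_1:
  assumes gain: "is_T_gain G \<phi>" and bal: "balanced G \<phi>" and "awalk u p u"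
  shows "walk_gain \<phi> p = 1"
  using assms(3)
proof (induction "length p" arbitrary: u p rule: less_induct)
  case less
  show ?case
  proof (cases p)
    case Nil
    then show ?thesis by simp
  next
    case p: (Cons e es)
    have es: "awalk (snd e) es u" and e: "e \<in> parcs G" "u = fst e"
      using less.prems p by (auto simp: awalk_Cons_iff)
    show ?thesis
    \<comment> \<open>The vertices of \<open>es\<close> are those of \<open>p\<close> without the
      first one, which is exactly the list that \<open>cycle\<close> requires to be
      distinct.\<close>
    proof (cases "distinct (pawalk_verts (snd e) es)")
      case True
      then have cyc: "cycle p"
        unfolding cycle_def using less.prems p by auto
      show ?thesis
      proof (cases "3 \<le> length p")
        case True
        then show ?thesis using bal cyc by (auto simp: balanced_def)
      next
        case False
        \<comment> \<open>These short cycles are not covered by \<open>balanced\<close>. Length 1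
          would be a loop; length 2 goes back and forth, with gain
          \<open>\<phi> e * cnj (\<phi> e) = 1\<close>.\<close>
        have "es \<noteq> []"
          using es e no_loops'[of "fst e" "snd e"] by (auto simp: awalk_Nil_iff)
        then obtain f where "es = [f]"
          using False p by (cases es) (auto simp: not_le)
        then have f: "f = (snd e, fst e)"
          using es e by (cases f) (auto simp: awalk_simps)
        have "cmod (\<phi> e) = 1" "\<phi> f = cnj (\<phi> e)"
          using gain e f by (cases e; auto simp: is_T_gain_def)+
        then show ?thesis
          using p \<open>es = [f]\<close> complex_norm_square[of "\<phi> e"] by simp
      qed
    next
      case False
      \<comment> \<open>Both \<open>r\<close> and \<open>e # q @ s\<close> are closed and shorter
        than \<open>p\<close>: the first omits \<open>e\<close>, the second omits the nonempty
        \<open>r\<close>.\<close>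
      then obtain q r s w where
        w: "es = q @ r @ s" "0 < length r" "awalk (snd e) q w" "awalk w r w" "awalk w s u"
        using awalk_not_distinct_decomp[OF es] by blast
      have "walk_gain \<phi> r = 1"
        using w p by (intro less.hyps[of r w]) auto
      moreover have "awalk u (e # q @ s) u"
        using w e by (auto simp: awalk_Cons_iff intro!: awalk_appendI)
      then have "walk_gain \<phi> (e # q @ s) = 1"
        using w p by (intro less.hyps[of _ u]) auto
      ultimately show ?thesis
        using p w(1) by simp
    qed
  qed
qed

text \<open>Following \<open>p\<close> and then \<open>q\<close> backwards gives a closed walk, and
  reversal inverts a gain of modulus 1.\<close>

lemma walk_gain_unique:
  assumes "is_T_gain G \<phi>" "balanced G \<phi>" and p: "awalk u p v" and q: "awalk u q v"
  shows "walk_gain \<phi> p = walk_gain \<phi> q"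
proof -
  have "awalk u (p @ rev_path q) u"
    using p by (rule awalk_appendI) (use q in simp)
  from closed_walk_gain_eq_1[OF assms(1,2) this]
  have "walk_gain \<phi> p * cnj (walk_gain \<phi> q) = 1"
    by (simp add: walk_gain_rev_path[OF assms(1) q])
  moreover have "walk_gain \<phi> q * cnj (walk_gain \<phi> q) = 1"
    using cmod_walk_gain[OF assms(1) q] complex_norm_square[of "walk_gain \<phi> q"] by simp
  ultimately show ?thesis
    by (metis mult_cancel_right mult_zero_right zero_neq_one)
qed

text \<open>Connectedness is defined through the symmetric closure of the digraph; as the arcs are
  symmetric already, reachability there and in \<open>G\<close> agree.\<close>

lemma connected_reachable:
  assumes "Digraph_Component.connected (with_proj G)" "u \<in> pverts G" "v \<in> pverts G"
  shows "u \<rightarrow>\<^sup>*\<^bsub>with_proj G\<^esub> v"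
  using assms reachable_mk_symmetric_eq[of u v] sym_arcs
  by (auto simp: Digraph_Component.connected_def strongly_connected_def)

lemma balanced_imp_potential:
  assumes conn: "Digraph_Component.connected (with_proj G)"
    and gain: "is_T_gain G \<phi>" and bal: "balanced G \<phi>"
  obtains \<theta> where "\<And>u. u \<in> pverts G \<Longrightarrow> cmod (\<theta> u) = 1"
    and "\<And>u p v. awalk u p v \<Longrightarrow> walk_gain \<phi> p = \<theta> u * cnj (\<theta> v)"
proof -
  obtain r where r: "r \<in> pverts G"
    using conn by (auto simp: Digraph_Component.connected_def strongly_connected_def)
  have "\<forall>u. \<exists>p. u \<in> pverts G \<longrightarrow> awalk u p r"
    using connected_reachable[OF conn _ r] by (auto simp: reachable_awalk)
  then obtain P where P: "\<And>u. u \<in> pverts G \<Longrightarrow> awalk u (P u) r"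
    by metis
  let ?\<theta> = "\<lambda>u. walk_gain \<phi> (P u)"
  have norm: "cmod (?\<theta> u) = 1" if "u \<in> pverts G" for u
    using cmod_walk_gain[OF gain P[OF that]] .
  moreover have "walk_gain \<phi> p = ?\<theta> u * cnj (?\<theta> v)" if p: "awalk u p v" for u p v
  proof -
    have uv: "u \<in> pverts G" "v \<in> pverts G"
      using p awalk_hd_in_verts awalk_last_in_verts by blast+
    have "awalk u (p @ P v) r"
      using p P[OF uv(2)] by (rule awalk_appendI)
    from walk_gain_unique[OF gain bal this P[OF uv(1)]]
    have "?\<theta> u = walk_gain \<phi> p * ?\<theta> v"
      by simp
    moreover have "?\<theta> v * cnj (?\<theta> v) = 1"
      using norm[OF uv(2)] complex_norm_square[of "?\<theta> v"] by simp
    ultimately show ?thesis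
      by (simp add: mult.assoc)
  qed
  ultimately show ?thesis
    by (rule that)
qed

section \<open>Distances and shortest paths\<close>

lemma awalk_cost_1: "awalk_cost (\<lambda>_. 1) p = real (length p)"
  by (induction p) auto

lemma gdist_le_length:
  assumes "awalk u p v"
  shows "gdist G u v \<le> real (length p)"
proof -
  \<comment> \<open>The infimum is attained by a walk, hence finite, so \<open>real_of_ereal\<close>
    does not fall back on its default 0 for infinite values.\<close>
  obtain q where "\<mu> (\<lambda>_. 1) u v = ereal (awalk_cost (\<lambda>_. 1) q)"
    using min_cost_awalk[of u v "\<lambda>_. 1"] assms by (auto simp: reachable_awalk)
  then show ?thesis
    using min_cost_le_walk_cost[OF assms, of "\<lambda>_. 1"] by (simp add: gdist_def awalk_cost_1)
qed

lemma finite_shortest_paths: "finite (shortest_paths G u v)"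
  using apaths_finite[of u v] by (rule rev_finite_subset) (auto simp: shortest_paths_def)

lemma shortest_paths_nonempty:
  assumes "u \<rightarrow>\<^sup>*\<^bsub>with_proj G\<^esub> v"
  shows "shortest_paths G u v \<noteq> {}"
proof -
  obtain p where "apath u p v" "\<mu> (\<lambda>_. 1) u v = ereal (awalk_cost (\<lambda>_. 1) p)"
    using min_cost_awalk[OF assms, of "\<lambda>_. 1"] by auto
  then have "p \<in> shortest_paths G u v"
    by (simp add: shortest_paths_def gdist_def awalk_cost_1)
  then show ?thesis
    by blast
qed

lemma shortest_paths_awalk: "p \<in> shortest_paths G u v \<Longrightarrow> awalk u p v"
  by (simp add: shortest_paths_def awalkI_apath)

lemma gdist_pos:
  assumes "u \<rightarrow>\<^sup>*\<^bsub>with_proj G\<^esub> v" "u \<noteq> v"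
  shows "gdist G u v > 0"
proof -
  obtain p where p: "p \<in> shortest_paths G u v"
    using shortest_paths_nonempty[OF assms(1)] by blast
  then have "p \<noteq> []"
    using assms(2) shortest_paths_awalk[OF p] by (auto simp: awalk_Nil_iff)
  moreover have "gdist G u v = real (length p)"
    using p by (simp add: shortest_paths_def)
  ultimately show ?thesis
    by simp
qed

lemma gdist_self:
  assumes "u \<in> pverts G"
  shows "gdist G u u = 0"
proof -
  obtain p where "p \<in> shortest_paths G u u"
    using shortest_paths_nonempty[of u u] assms by auto
  then have "gdist G u u = real (length p)"
    by (simp add: shortest_paths_def)
  moreover have "gdist G u u \<le> 0"
    using gdist_le_length[of u "[]" u] assms by (simp add: awalk_Nil_iff)
  ultimately show ?thesis
    by simp
qed

text \<open>The arc bounds the distance by 1, and a single arc is determined by its ends. This is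
  what lets the gain matrices recover \<open>\<phi>\<close> on edges.\<close>

lemma shortest_paths_arc:
  assumes "(u, v) \<in> parcs G"
  shows "shortest_paths G u v = {[(u, v)]}"
proof -
  have "u \<noteq> v"
    using assms by (rule no_loops')
  have walk: "awalk u [(u, v)] v"
    using arc_implies_awalk[OF assms] by simp
  have "p = [(u, v)]" if "p \<in> shortest_paths G u v" for p
  proof -
    have p: "awalk u p v" "real (length p) = gdist G u v"
      using that shortest_paths_awalk by (auto simp: shortest_paths_def)
    then have "length p \<le> 1"
      using gdist_le_length[OF walk] by simp
    moreover have "p \<noteq> []"
      using p(1) \<open>u \<noteq> v\<close> by (auto simp: awalk_Nil_iff)
    ultimately obtain e where "p = [e]"
      by (cases p) auto
    then show ?thesis
      using p(1) by (cases e) (auto simp: awalk_simps)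
  qed
  moreover have "shortest_paths G u v \<noteq> {}"
    using walk by (intro shortest_paths_nonempty) (auto simp: reachable_awalk)
  ultimately show ?thesis
    by blast
qed

end

section \<open>Lexicographic extrema and gains between vertex pairs\<close>

lemma lex_le_antisym: "lex_le z w \<Longrightarrow> lex_le w z \<Longrightarrow> z = w"
  by (auto simp: lex_le_def complex_eq_iff)

text \<open>The definite description is meaningful here: a maximum exists by induction on the finite
  set and is unique by antisymmetry.\<close>

lemma lex_Max_in:
  assumes "finite S" "S \<noteq> {}"
  shows "lex_Max S \<in> S"
proof -
  have "\<exists>z\<in>S. \<forall>w\<in>S. lex_le w z"
    using assms
  proof (induction rule: finite_ne_induct)
    case (insert a F)
    then obtain z where "z \<in> F" "\<forall>w\<in>F. lex_le w z"
      by blast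
    then show ?case
      by (cases "lex_le a z") (force simp: lex_le_def)+
  qed (simp add: lex_le_def)
  then have "\<exists>!z. z \<in> S \<and> (\<forall>w\<in>S. lex_le w z)"
    using lex_le_antisym by blast
  from theI'[OF this] show ?thesis
    unfolding lex_Max_def by blast
qed

lemma lex_Max_singleton [simp]: "lex_Max {z} = z"
  using lex_Max_in[of "{z}"] by simp

lemma lex_Min_singleton [simp]: "lex_Min {z} = z"
  unfolding lex_Min_def by (rule the_equality) (auto simp: lex_le_def)

context pair_graph
begin

text \<open>The only shortest path is the arc itself, and conjugation matches reversal of the arc,
  so either branch of \<open>lt\<close> gives the same value.\<close>

lemma gain_max_arc:
  assumes "is_T_gain G \<phi>" "(u, v) \<in> parcs G"
  shows "gain_max lt G \<phi> u v = \<phi> (u, v)"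
proof -
  have "(v, u) \<in> parcs G" "u \<noteq> v"
    using assms arcs_symmetric no_loops' by blast+
  moreover have "\<phi> (u, v) = cnj (\<phi> (v, u))"
    using assms by (auto simp: is_T_gain_def)
  ultimately show ?thesis
    using assms(2) by (auto simp: gain_max_def shortest_paths_arc)
qed

lemma cmod_lex_Max_gain:
  assumes "is_T_gain G \<phi>" "u \<rightarrow>\<^sup>*\<^bsub>with_proj G\<^esub> v"
  shows "cmod (lex_Max (walk_gain \<phi> ` shortest_paths G u v)) = 1"
proof -
  have "lex_Max (walk_gain \<phi> ` shortest_paths G u v) \<in> walk_gain \<phi> ` shortest_paths G u v"
    using finite_shortest_paths shortest_paths_nonempty[OF assms(2)] by (intro lex_Max_in) auto
  then show ?thesis
    using cmod_walk_gain[OF assms(1) shortest_paths_awalk] by auto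
qed

text \<open>Only an inequality, because the diagonal values are 0; off the diagonal the modulus is
  1.\<close>

lemma cmod_gain_max_le:
  assumes "Digraph_Component.connected (with_proj G)" "is_T_gain G \<phi>"
    and "u \<in> pverts G" "v \<in> pverts G"
  shows "cmod (gain_max lt G \<phi> u v) \<le> 1"
  using cmod_lex_Max_gain[OF assms(2)] connected_reachable[OF assms(1)] assms(3,4)
  by (simp add: gain_max_def)

text \<open>All shortest paths between two vertices share one gain, so maximum and minimum are taken
  over a singleton; conjugating the value for \<open>(v, u)\<close> returns that for
  \<open>(u, v)\<close>.\<close>

lemma gain_max_min_potential:
  assumes conn: "Digraph_Component.connected (with_proj G)"
    and \<theta>: "\<And>u p v. awalk u p v \<Longrightarrow> walk_gain \<phi> p = \<theta> u * cnj (\<theta> v)"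
    and uv: "u \<in> pverts G" "v \<in> pverts G" "u \<noteq> v"
  shows "gain_max lt G \<phi> u v = \<theta> u * cnj (\<theta> v)"
    and "gain_min lt G \<phi> u v = \<theta> u * cnj (\<theta> v)"
proof -
  have "walk_gain \<phi> ` shortest_paths G s t = {\<theta> s * cnj (\<theta> t)}"
    if "s \<in> pverts G" "t \<in> pverts G" for s t
  proof -
    have "walk_gain \<phi> p = \<theta> s * cnj (\<theta> t)" if "p \<in> shortest_paths G s t" for p
      using \<theta>[OF shortest_paths_awalk[OF that]] .
    then show ?thesis
      using shortest_paths_nonempty[OF connected_reachable[OF conn that]]
      by (auto simp: image_constant_conv cong: image_cong)
  qed
  then show "gain_max lt G \<phi> u v = \<theta> u * cnj (\<theta> v)" "gain_min lt G \<phi> u v = \<theta> u * cnj (\<theta> v)"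
    using uv by (simp_all add: gain_max_def gain_min_def)
qed

end

section \<open>Kernel vectors of distance Laplacians\<close>

text \<open>Equality case of the triangle inequality: up to normalisation \<open>z\<close> is a
  weighted mean of points \<open>g j * x j\<close> of modulus at most \<open>cmod z\<close>, so
  every point of positive weight must be \<open>z\<close>.\<close>

lemma weighted_sum_eq_at_max_modulus:
  fixes w :: "'i \<Rightarrow> real" and g x :: "'i \<Rightarrow> complex"
  assumes "finite V" and w: "\<And>j. j \<in> V \<Longrightarrow> w j \<ge> 0"
    and g: "\<And>j. j \<in> V \<Longrightarrow> cmod (g j) \<le> 1"
    and max: "\<And>j. j \<in> V \<Longrightarrow> cmod (x j) \<le> cmod z"
    and eq: "of_real (\<Sum>j\<in>V. w j) * z = (\<Sum>j\<in>V. g j * of_real (w j) * x j)"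
    and j: "j \<in> V" "w j > 0"
  shows "z = g j * x j"
proof -
  define y where "y j = g j * x j" for j
  have y: "cmod (y k) \<le> cmod z" if "k \<in> V" for k
    using mult_mono[OF g[OF that] max[OF that]] by (simp add: y_def norm_mult)
  \<comment> \<open>\<open>h k\<close> is the defect of \<open>y k\<close> in the direction of
    \<open>z\<close>. The defects are nonnegative and their weighted sum vanishes by
    \<open>eq\<close>.\<close>
  define h where "h k = (cmod z)\<^sup>2 - Re (cnj z * y k)" for k
  have h: "h k \<ge> 0" if "k \<in> V" for k
  proof -
    have "Re (cnj z * y k) \<le> cmod z * cmod (y k)"
      using complex_Re_le_cmod[of "cnj z * y k"] by (simp add: norm_mult)
    also have "\<dots> \<le> cmod z * cmod z"
      using y[OF that] by (simp add: mult_left_mono)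
    finally show ?thesis
      by (simp add: h_def power2_eq_square)
  qed
  have "(\<Sum>k\<in>V. w k * h k) = (\<Sum>k\<in>V. w k) * (cmod z)\<^sup>2 - Re (cnj z * (\<Sum>k\<in>V. of_real (w k) * y k))"
    by (simp add: h_def right_diff_distrib distrib_left sum_subtractf sum_distrib_left
        sum_distrib_right mult_ac)
  also have "(\<Sum>k\<in>V. of_real (w k) * y k) = of_real (\<Sum>j\<in>V. w j) * z"
    unfolding eq y_def by (simp add: mult_ac)
  also have "Re (cnj z * (of_real (\<Sum>j\<in>V. w j) * z)) = (\<Sum>k\<in>V. w k) * (cmod z)\<^sup>2"
    by (simp only: cmod_power2) (simp add: algebra_simps power2_eq_square)
  finally have "(\<Sum>k\<in>V. w k * h k) = 0"
    by simp
  then have "h j = 0"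
    using j w h by (subst (asm) sum_nonneg_eq_0_iff) (auto simp: \<open>finite V\<close>)
  \<comment> \<open>Expanding the square produces the cross term
    \<open>- 2 * Re (cnj z * y j)\<close>, which is \<open>- 2 * (cmod z)\<^sup>2\<close> because
    \<open>h j = 0\<close>.\<close>
  then have "(cmod (z - y j))\<^sup>2 = (cmod (y j))\<^sup>2 - (cmod z)\<^sup>2"
    unfolding h_def cmod_power2 by (simp add: power2_eq_square algebra_simps)
  also have "\<dots> \<le> 0"
    using y[OF j(1)] by (simp add: power_mono)
  finally show ?thesis
    by (simp add: y_def)
qed

text \<open>The characteristic polynomial is monic, hence nonzero, so \<open>proots\<close> contains
  exactly its roots.\<close>

lemma spectrum_mset_eigenvalue:
  assumes "A \<in> carrier_mat n n"
  shows "k \<in># spectrum_mset A \<longleftrightarrow> eigenvalue A k"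
proof -
  have "char_poly A \<noteq> 0"
    using degree_monic_char_poly[OF assms] by auto
  then show ?thesis
    by (simp add: spectrum_mset_def eigenvalue_root_char_poly[OF assms])
qed

lemma DL_carrier: "DL n G \<in> carrier_mat n n" "DL_max n G \<phi> \<in> carrier_mat n n"
  by (auto simp: DL_def DL_max_def Tr_mat_def dist_mat_def D_max_def mat_diag_def)

text \<open>Every row of \<open>DL n G\<close> sums to 0, the transmission being the row sum of the
  distances.\<close>

lemma eigenvalue_DL_0:
  assumes "pverts G = {..<n}" "n > 0"
  shows "eigenvalue (DL n G) 0"
  unfolding eigenvalue_def eigenvector_def
proof (intro exI conjI)
  let ?v = "vec n (\<lambda>_. 1 :: complex)"
  show "?v \<in> carrier_vec (dim_row (DL n G))"
    using DL_carrier(1)[of n G] by auto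
  have "?v $ 0 \<noteq> 0\<^sub>v (dim_row (DL n G)) $ 0"
    using assms(2) DL_carrier(1)[of n G] by auto
  then show "?v \<noteq> 0\<^sub>v (dim_row (DL n G))"
    by metis
  show "DL n G *\<^sub>v ?v = 0 \<cdot>\<^sub>v ?v"
  proof (rule eq_vecI)
    fix i
    assume "i < dim_vec (0 \<cdot>\<^sub>v ?v)"
    then have i: "i < n"
      by simp
    have "(DL n G *\<^sub>v ?v) $ i = (\<Sum>j<n. DL n G $$ (i, j))"
      using i DL_carrier(1)[of n G] by (auto simp: scalar_prod_def atLeast0LessThan intro!: sum.cong)
    also have "\<dots> = (\<Sum>j<n. (if i = j then complex_of_real (transmission G i) else 0)
                      - complex_of_real (gdist G i j))"
      using i by (intro sum.cong) (auto simp: DL_def Tr_mat_def mat_diag_def dist_mat_def)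
    also have "\<dots> = 0"
      using i by (simp add: sum_subtractf transmission_def assms(1))
    finally show "(DL n G *\<^sub>v ?v) $ i = (0 \<cdot>\<^sub>v ?v) $ i"
      using i by simp
  qed (use DL_carrier(1)[of n G] in auto)
qed

lemma eigenvalue_DL_max_0_imp_balanced:
  assumes "pair_graph G" and V: "pverts G = {..<n}"
    and conn: "Digraph_Component.connected (with_proj G)" and gain: "is_T_gain G \<phi>"
    and ev: "eigenvalue (DL_max n G \<phi>) 0"
  shows "balanced G \<phi>"
proof -
  interpret pair_graph G by fact
  let ?g = "gain_max (<) G \<phi>"
  obtain v where v: "v \<in> carrier_vec n" "v \<noteq> 0\<^sub>v n" "DL_max n G \<phi> *\<^sub>v v = 0 \<cdot>\<^sub>v v"
    using ev DL_carrier(2)[of n G \<phi>] by (auto simp: eigenvalue_def eigenvector_def)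
  define x where "x i = v $ i" for i
  \<comment> \<open>Row \<open>i\<close> of the kernel equation, with the diagonal term moved to the
    left, in the shape of the weighted-mean lemma with the distances as weights.\<close>
  have row: "of_real (\<Sum>j\<in>pverts G. gdist G i j) * x i
      = (\<Sum>j\<in>pverts G. ?g i j * of_real (gdist G i j) * x j)" if i: "i < n" for i
  proof -
    have "0 = (DL_max n G \<phi> *\<^sub>v v) $ i"
      using v(1,3) i by simp
    also have "\<dots> = (\<Sum>j<n. DL_max n G \<phi> $$ (i, j) * x j)"
      using i DL_carrier(2)[of n G \<phi>] v(1)
      by (auto simp: scalar_prod_def atLeast0LessThan x_def intro!: sum.cong)
    also have "\<dots> = (\<Sum>j<n. (if i = j then of_real (transmission G i) * x i else 0)
                      - ?g i j * of_real (gdist G i j) * x j)"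
      using i
      by (intro sum.cong) (auto simp: DL_max_def Tr_mat_def mat_diag_def D_max_def algebra_simps)
    also have "\<dots> = of_real (transmission G i) * x i
                      - (\<Sum>j<n. ?g i j * of_real (gdist G i j) * x j)"
      using i by (simp add: sum_subtractf)
    finally show ?thesis
      by (simp add: transmission_def V)
  qed
  have dist: "gdist G i j \<ge> 0" "i \<noteq> j \<Longrightarrow> gdist G i j > 0" if "i < n" "j < n" for i j
    using gdist_pos[of i j] gdist_self[of i] connected_reachable[OF conn] that
    by (cases "i = j"; force simp: V)+
  \<comment> \<open>Applied with \<open>z = x m\<close> for an entry of maximal modulus;
    \<open>j \<noteq> m\<close> makes the weight \<open>gdist G m j\<close> positive.\<close>
  have step: "x m = ?g m j * x j"
    if m: "m < n" "\<And>k. k < n \<Longrightarrow> cmod (x k) \<le> cmod (x m)" and j: "j < n" "j \<noteq> m" for m j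
    using m j dist
    by (intro weighted_sum_eq_at_max_modulus[OF finite_verts _ _ _ row])
      (auto simp: V intro!: cmod_gain_max_le[OF conn gain])
  obtain i\<^sub>0 where i\<^sub>0: "i\<^sub>0 < n" "x i\<^sub>0 \<noteq> 0"
    using v(1,2) by (auto simp: x_def vec_eq_iff)
  obtain m where m: "m < n" "\<And>k. k < n \<Longrightarrow> cmod (x k) \<le> cmod (x m)"
    using Max_in[of "(\<lambda>k. cmod (x k)) ` {..<n}"] Max_ge[of "(\<lambda>k. cmod (x k)) ` {..<n}"] i\<^sub>0(1)
    by fastforce
  \<comment> \<open>Hence all entries have maximal modulus, and \<open>step\<close> becomes
    available at every vertex in the role of \<open>m\<close>.\<close>
  have "cmod (x m) \<le> cmod (x j)" if j: "j < n" for j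
  proof (cases "j = m")
    case False
    have "cmod (x m) = cmod (?g m j) * cmod (x j)"
      using step[OF m j False] by (simp add: norm_mult)
    also have "\<dots> \<le> 1 * cmod (x j)"
      using cmod_gain_max_le[OF conn gain] m j by (intro mult_right_mono) (auto simp: V)
    finally show ?thesis
      by simp
  qed simp
  then have max: "cmod (x k) \<le> cmod (x j)" if "j < n" "k < n" for j k
    using m(2) that order_trans by blast
  show ?thesis
  proof (rule balanced_if_potential)
    fix u v
    assume uv: "(u, v) \<in> parcs G"
    then have "u < n" "v < n" "v \<noteq> u"
      using in_arcsD1 in_arcsD2 no_loops' V by blast+
    then show "x u = \<phi> (u, v) * x v"
      using step[of u v] max gain_max_arc[OF gain uv] by simp
  next
    fix u
    assume "u \<in> pverts G"
    then show "x u \<noteq> 0"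
      using max[of u i\<^sub>0] i\<^sub>0 by (auto simp: V)
  qed
qed

section \<open>Balance as diagonal similarity\<close>

text \<open>The matrices get one formula for all \<open>lt\<close>, which yields ordering
  independence and the equality of the two Laplacians together.\<close>

lemma balanced_imp_switching:
  assumes "pair_graph G" and V: "pverts G = {..<n}"
    and conn: "Digraph_Component.connected (with_proj G)" and gain: "is_T_gain G \<phi>"
    and bal: "balanced G \<phi>"
  obtains \<theta> where "\<And>i. i < n \<Longrightarrow> cmod (\<theta> i) = 1"
    and "\<And>lt. D_max lt n G \<phi> = mat n n (\<lambda>(i, j). \<theta> i * cnj (\<theta> j) * of_real (gdist G i j))"
    and "\<And>lt. D_min lt n G \<phi> = mat n n (\<lambda>(i, j). \<theta> i * cnj (\<theta> j) * of_real (gdist G i j))"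
proof -
  interpret pair_graph G by fact
  obtain \<theta> where \<theta>: "\<And>u. u \<in> pverts G \<Longrightarrow> cmod (\<theta> u) = 1"
    "\<And>u p v. awalk u p v \<Longrightarrow> walk_gain \<phi> p = \<theta> u * cnj (\<theta> v)"
    using balanced_imp_potential[OF conn gain bal] by blast
  have gains: "gain_max lt G \<phi> i j * of_real (gdist G i j) = \<theta> i * cnj (\<theta> j) * of_real (gdist G i j)
      \<and> gain_min lt G \<phi> i j * of_real (gdist G i j) = \<theta> i * cnj (\<theta> j) * of_real (gdist G i j)"
    if ij: "i < n" "j < n" for lt i j
  proof (cases "i = j")
    \<comment> \<open>On the diagonal the gain functions are 0 while
      \<open>\<theta> i * cnj (\<theta> i)\<close> is 1; the distance 0 removes the
      difference.\<close>
    case True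
    then show ?thesis
      using gdist_self[of i] ij by (simp add: V)
  next
    case False
    then have "gain_max lt G \<phi> i j = \<theta> i * cnj (\<theta> j)" "gain_min lt G \<phi> i j = \<theta> i * cnj (\<theta> j)"
      using ij by (intro gain_max_min_potential[OF conn \<theta>(2)]; simp add: V)+
    then show ?thesis
      by simp
  qed
  show ?thesis
  proof (rule that[of \<theta>])
    show "cmod (\<theta> i) = 1" if "i < n" for i
      using \<theta>(1) that by (simp add: V)
    show "D_max lt n G \<phi> = mat n n (\<lambda>(i, j). \<theta> i * cnj (\<theta> j) * of_real (gdist G i j))"
      "D_min lt n G \<phi> = mat n n (\<lambda>(i, j). \<theta> i * cnj (\<theta> j) * of_real (gdist G i j))" for lt
      unfolding D_max_def D_min_def by (rule cong_mat; use gains in simp)+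
  qed
qed

text \<open>As the entries of \<open>\<theta>\<close> have modulus 1, the conjugate diagonal matrix
  is the inverse of \<open>mat_diag n \<theta>\<close>, so this is a similarity.\<close>

lemma char_poly_diag_conj:
  fixes A :: "complex mat"
  assumes A: "A \<in> carrier_mat n n" and \<theta>: "\<And>i. i < n \<Longrightarrow> cmod (\<theta> i) = 1"
  shows "char_poly (mat n n (\<lambda>(i, j). \<theta> i * cnj (\<theta> j) * A $$ (i, j))) = char_poly A"
    (is "char_poly ?B = _")
proof -
  let ?P = "mat_diag n \<theta>" and ?Q = "mat_diag n (\<lambda>i. cnj (\<theta> i))"
  have *: "\<theta> i * cnj (\<theta> i) = 1" if "i < n" for i
    using \<theta>[OF that] complex_norm_square[of "\<theta> i"] by simp
  have PQ: "?P * ?Q = 1\<^sub>m n" "?Q * ?P = 1\<^sub>m n"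
    unfolding mat_diag_diag using * by (auto simp: mat_diag_def mult.commute intro: eq_matI)
  have PA: "?P * A = mat n n (\<lambda>(i, j). \<theta> i * A $$ (i, j))"
    using A by (rule mat_diag_mult_left)
  have "?P * A * ?Q = mat n n (\<lambda>(i, j). (?P * A) $$ (i, j) * cnj (\<theta> j))"
    unfolding PA by (rule mat_diag_mult_right) simp
  then have B: "?B = ?P * A * ?Q"
    unfolding PA by (auto intro: eq_matI)
  have "{?B, A, ?P, ?Q} \<subseteq> carrier_mat n n"
    using A by simp
  then have "similar_mat ?B A"
    using PQ B by (rule similar_matI[of ?B A ?P ?Q n])
  then show ?thesis
    by (rule char_poly_similar)
qed

theorem theorem3p4:
  fixes G :: "nat pair_pre_digraph" and \<phi> :: "nat \<times> nat \<Rightarrow> complex" and n :: nat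
  assumes "pair_graph G"
    and "pverts G = {..<n}"
    and "Digraph_Component.connected (with_proj G)"
    and "is_T_gain G \<phi>"
  shows "balanced G \<phi> \<longleftrightarrow>
    ordering_independent n G \<phi> \<and>
    DL_max n G \<phi> = DL_min n G \<phi> \<and>
    spectrum_mset (DL_max n G \<phi>) = spectrum_mset (DL n G)"
proof
  assume "balanced G \<phi>"
  then obtain \<theta> where \<theta>: "\<And>i. i < n \<Longrightarrow> cmod (\<theta> i) = 1"
    and D: "\<And>lt. D_max lt n G \<phi> = mat n n (\<lambda>(i, j). \<theta> i * cnj (\<theta> j) * of_real (gdist G i j))"
      "\<And>lt. D_min lt n G \<phi> = mat n n (\<lambda>(i, j). \<theta> i * cnj (\<theta> j) * of_real (gdist G i j))"
    using balanced_imp_switching[OF assms] by blast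
  have unit: "\<theta> i * cnj (\<theta> i) = 1" if "i < n" for i
    using \<theta>[OF that] complex_norm_square[of "\<theta> i"] by simp
  \<comment> \<open>The conjugation fixes the transmission part, since \<open>unit\<close> makes its
    diagonal factors 1.\<close>
  have "DL_max n G \<phi> = mat n n (\<lambda>(i, j). \<theta> i * cnj (\<theta> j) * DL n G $$ (i, j))"
    using unit unfolding DL_max_def DL_def D
    by (auto simp: Tr_mat_def mat_diag_def dist_mat_def right_diff_distrib intro: eq_matI)
  then have "spectrum_mset (DL_max n G \<phi>) = spectrum_mset (DL n G)"
    using char_poly_diag_conj[OF DL_carrier(1) \<theta>] by (simp add: spectrum_mset_def)
  then show "ordering_independent n G \<phi> \<and> DL_max n G \<phi> = DL_min n G \<phi> \<and>
    spectrum_mset (DL_max n G \<phi>) = spectrum_mset (DL n G)"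
    by (simp add: ordering_independent_def DL_max_def DL_min_def D)
next
  assume *: "ordering_independent n G \<phi> \<and> DL_max n G \<phi> = DL_min n G \<phi> \<and>
    spectrum_mset (DL_max n G \<phi>) = spectrum_mset (DL n G)"
  have "pverts G \<noteq> {}"
    using assms(3) by (auto simp: Digraph_Component.connected_def strongly_connected_def)
  then have "n > 0"
    using assms(2) by auto
  then have "eigenvalue (DL_max n G \<phi>) 0"
    using eigenvalue_DL_0[OF assms(2)] * spectrum_mset_eigenvalue DL_carrier by metis
  then show "balanced G \<phi>"
    by (rule eigenvalue_DL_max_0_imp_balanced[OF assms])
qed

end
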